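(* Let $(A,\Omega_A,u,\mathcal{G}_A)$ be a system in the sense of the context below, and suppose it is bit-symmetric. Then it is self-dual. Moreover, the inner product $\langle\cdot,\cdot\rangle$ on $A$ witnessing self-duality can be chosen such that: (1) $\langle \omega,\varphi\rangle\geq 0$ for all $\omega,\varphi\in\Omega_A$; (2) $\langle Tx,Ty\rangle=\langle x,y\rangle$ for all $T\in\mathcal{G}_A$ and $x,y\in A$; (3) $\langle\omega,\omega\rangle=1$ for every pure state $\omega\in\Omega_A$; (4) $\langle \omega,\varphi\rangle=0$ whenever $\omega,\varphi\in\Omega_A$ are perfectly distinguishable.
   Context: A system consists of: a finite-dimensional real vector space $A$; a compact convex set $\Omega_A\subset A$ (the normalized states) such that the cone $A_+:=\{\lambda\omega:\lambda\geq 0,\ \omega\in\Omega_A\}$ spans $A$; a linear functional $u:A\to\mathbb{R}$ (the unit) with $u(\omega)=1$ for all $\omega\in\Omega_A$; and a compact group $\mathcal{G}_A$ of invertible linear maps $T:A\to A$ with $T(\Omega_A)=\Omega_A$ (the reversible transformations). A state is pure if it is an extreme point of $\Omega_A$. The effect cone $A_+^*$ is the set of linear functionals $E:A\to\mathbb{R}$ with $E(x)\geq 0$ for all $x\in A_+$; an effect $E$ is proper if $0\leq E(\omega)\leq 1$ for all $\omega\in\Omega_A$. Two states $\varphi,\omega\in\Omega_A$ are perfectly distinguishable if there is a proper effect $E$ with $E(\varphi)=0$ and $E(\omega)=1$. The system is bit-symmetric if whenever $\varphi,\omega$ are perfectly distinguishable pure states and $\varphi',\omega'$ are perfectly distinguishable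 pure states, there exists $T\in\mathcal{G}_A$ with $T\varphi=\varphi'$ and $T\omega=\omega'$. The system is self-dual if there exists an inner product $\langle\cdot,\cdot\rangle$ on $A$ such that $A_+^*=\{x\mapsto\langle x,\varphi\rangle : \varphi\in A_+\}$. *)

theory Defs
  imports "HOL-Analysis.Analysis"
begin

text \<open>A finite-dimensional real vector space A is modelled by a type of class
euclidean_space (its built-in inner product is NOT used; inner products are
explicit bilinear forms below).\<close>

definition state_cone :: "'a::euclidean_space set \<Rightarrow> 'a set" where
  "state_cone \<Omega> = {c *\<^sub>R w | c w. c \<ge> 0 \<and> w \<in> \<Omega>}"

definition is_system :: "'a::euclidean_space set \<Rightarrow> ('a \<Rightarrow> real) \<Rightarrow> ('a \<Rightarrow> 'a) set \<Rightarrow> bool" where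
  "is_system \<Omega> u G \<longleftrightarrow>
     compact \<Omega> \<and> convex \<Omega> \<and> span (state_cone \<Omega>) = UNIV \<and>
     linear u \<and> (\<forall>w\<in>\<Omega>. u w = 1) \<and>
     (\<forall>T\<in>G. linear T \<and> bij T \<and> T ` \<Omega> = \<Omega>) \<and>
     id \<in> G \<and> (\<forall>S\<in>G. \<forall>T\<in>G. S \<circ> T \<in> G) \<and> (\<forall>T\<in>G. inv T \<in> G) \<and>
     compact (Blinfun ` G)"

definition pure_state :: "'a::euclidean_space set \<Rightarrow> 'a \<Rightarrow> bool" where
  "pure_state \<Omega> w \<longleftrightarrow> w extreme_point_of \<Omega>"

definition effect_cone :: "'a::euclidean_space set \<Rightarrow> ('a \<Rightarrow> real) set" where
  "effect_cone \<Omega> = {E. linear E \<and> (\<forall>x\<in>state_cone \<Omega>. E x \<ge> 0)}"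

definition proper_effect :: "'a::euclidean_space set \<Rightarrow> ('a \<Rightarrow> real) \<Rightarrow> bool" where
  "proper_effect \<Omega> E \<longleftrightarrow> E \<in> effect_cone \<Omega> \<and> (\<forall>w\<in>\<Omega>. 0 \<le> E w \<and> E w \<le> 1)"

definition perfectly_distinguishable :: "'a::euclidean_space set \<Rightarrow> 'a \<Rightarrow> 'a \<Rightarrow> bool" where
  "perfectly_distinguishable \<Omega> \<phi> w \<longleftrightarrow>
     \<phi> \<in> \<Omega> \<and> w \<in> \<Omega> \<and> (\<exists>E. proper_effect \<Omega> E \<and> E \<phi> = 0 \<and> E w = 1)"

definition bit_symmetric :: "'a::euclidean_space set \<Rightarrow> ('a \<Rightarrow> 'a) set \<Rightarrow> bool" where
  "bit_symmetric \<Omega> G \<longleftrightarrow>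
     (\<forall>\<phi> w \<phi>' w'. pure_state \<Omega> \<phi> \<and> pure_state \<Omega> w \<and> perfectly_distinguishable \<Omega> \<phi> w \<and>
        pure_state \<Omega> \<phi>' \<and> pure_state \<Omega> w' \<and> perfectly_distinguishable \<Omega> \<phi>' w' \<longrightarrow>
        (\<exists>T\<in>G. T \<phi> = \<phi>' \<and> T w = w'))"

definition is_inner_product :: "('a::euclidean_space \<Rightarrow> 'a \<Rightarrow> real) \<Rightarrow> bool" where
  "is_inner_product B \<longleftrightarrow> bilinear B \<and> (\<forall>x y. B x y = B y x) \<and> (\<forall>x. x \<noteq> 0 \<longrightarrow> B x x > 0)"

definition self_dual_wrt :: "'a::euclidean_space set \<Rightarrow> ('a \<Rightarrow> 'a \<Rightarrow> real) \<Rightarrow> bool" where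
  "self_dual_wrt \<Omega> B \<longleftrightarrow> is_inner_product B \<and>
     effect_cone \<Omega> = {(\<lambda>x. B x \<phi>) | \<phi>. \<phi> \<in> state_cone \<Omega>}"

end

theory Submission
  imports Defs
begin

text \<open>
  Start from an inner product \<open>A\<close> invariant under the group; it exists because a bounded group of
  linear maps fixes the unique minimizer of an invariant, strictly convex norm on a closed convex
  invariant set of forms. Bit symmetry makes the group transitive on pure states, so all of them have
  the same length \<open>r\<close>. Let \<open>c\<close> be the least value of \<open>A\<close> on pairs of states. It is attained at a pure
  pair, which is then perfectly distinguishable by the functional \<open>A \<alpha>\<close>, and bit symmetry carries the
  value \<open>c\<close> to every perfectly distinguishable pure pair. Hence \<open>(A x y - c * u x * u y) / (r - c)\<close> is
  nonnegative on states and vanishes on distinguishable pairs, and it is positive definite because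
  \<open>c\<close> is smaller than the squared length of the invariant state. Self-duality follows from
  orthogonality of distinguishable states by projecting a functional onto the state cone.
\<close>

subsection \<open>Invariant inner products\<close>

text \<open>The orbit supremum \<open>N\<close> is a norm that no element of \<open>\<Gamma>\<close>
  increases, so each \<open>T\<close> sends a minimizer of \<open>N\<close> on \<open>C\<close> to a
  minimizer. Uniqueness then makes it a fixed point. The bound \<open>lower\<close> stands in for
  inverses.\<close>

lemma bounded_monoid_fixed_point:
  fixes C :: "'a::euclidean_space set" and \<Gamma> :: "('a \<Rightarrow> 'a) set"
  assumes C: "closed C" "convex C" "C \<noteq> {}"
    and lin: "\<And>T. T \<in> \<Gamma> \<Longrightarrow> linear T"
    and inv: "\<And>T x. T \<in> \<Gamma> \<Longrightarrow> x \<in> C \<Longrightarrow> T x \<in> C"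
    and id: "id \<in> \<Gamma>"
    and comp: "\<And>S T. S \<in> \<Gamma> \<Longrightarrow> T \<in> \<Gamma> \<Longrightarrow> S \<circ> T \<in> \<Gamma>"
    and upper: "\<And>T x. T \<in> \<Gamma> \<Longrightarrow> norm (T x) \<le> K * norm x"
    and lower: "\<And>T x. T \<in> \<Gamma> \<Longrightarrow> norm x \<le> K * norm (T x)"
    and K: "K > 0"
  shows "\<exists>x\<in>C. \<forall>T\<in>\<Gamma>. T x = x"
proof -
  define N where "N x = (SUP T\<in>\<Gamma>. norm (T x))" for x
  have bdd: "bdd_above ((\<lambda>T. norm (T x)) ` \<Gamma>)" for x
    using upper by (intro bdd_aboveI[of _ "K * norm x"]) auto
  have le_N: "norm (T x) \<le> N x" if "T \<in> \<Gamma>" for T x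
    unfolding N_def using bdd that by (rule cSUP_upper2) auto
  have N_le: "N x \<le> c" if "\<And>T. T \<in> \<Gamma> \<Longrightarrow> norm (T x) \<le> c" for x c
    unfolding N_def using id that by (intro cSUP_least) auto
  have N_diff: "N x \<le> N y + K * norm (x - y)" for x y
  proof (rule N_le)
    fix T assume T: "T \<in> \<Gamma>"
    have "T x = T y + T (x - y)"
      using lin[OF T] by (simp add: linear_diff)
    then have "norm (T x) \<le> norm (T y) + norm (T (x - y))"
      by (simp add: norm_triangle_ineq)
    then show "norm (T x) \<le> N y + K * norm (x - y)"
      using le_N[OF T, of y] upper[OF T, of "x - y"] by linarith
  qed
  have "\<bar>N x - N y\<bar> \<le> K * norm (x - y)" for x y
    using N_diff[of x y] N_diff[of y x] by (simp add: norm_minus_commute abs_le_iff)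
  then have "K-lipschitz_on UNIV N"
    using K by (intro lipschitz_onI) (auto simp: dist_norm)
  then have cont: "continuous_on UNIV N"
    by (rule lipschitz_on_continuous_on)
  obtain c where c: "c \<in> C" using C by auto
  \<comment> \<open>\<open>C\<close> may be unbounded. Since \<open>id\<close> belongs to
    \<open>\<Gamma>\<close>, a point of norm above \<open>N c\<close> also has \<open>N\<close>
    above \<open>N c\<close>, so minimizing over this ball is enough.\<close>
  have "\<exists>x\<in>C \<inter> cball 0 (N c). \<forall>y\<in>C \<inter> cball 0 (N c). N x \<le> N y"
  proof (rule continuous_attains_inf)
    show "compact (C \<inter> cball 0 (N c))" using C by (simp add: closed_Int_compact)
    show "C \<inter> cball 0 (N c) \<noteq> {}" using c le_N[OF id, of c] by auto
    show "continuous_on (C \<inter> cball 0 (N c)) N"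
      using cont continuous_on_subset by blast
  qed
  then obtain x where x: "x \<in> C" and min0: "\<And>y. y \<in> C \<Longrightarrow> norm y \<le> N c \<Longrightarrow> N x \<le> N y"
    by auto
  have min: "N x \<le> N y" if "y \<in> C" for y
  proof (cases "norm y \<le> N c")
    case True then show ?thesis using min0 that by blast
  next
    case False
    moreover have "norm y \<le> N y" using le_N[OF id, of y] by simp
    moreover have "N x \<le> N c" using min0[OF c] le_N[OF id, of c] by simp
    ultimately show ?thesis by linarith
  qed
  \<comment> \<open>By the parallelogram law applied to each \<open>T x\<close>, \<open>T y\<close>, two distinct minimizers would have
    a midpoint with a strictly smaller norm; \<open>lower\<close> makes the gain uniform in \<open>T\<close>.\<close>
  have uniq: "y = x" if y: "y \<in> C" "N y \<le> N x" for y
  proof -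
    define z where "z = (1/2) *\<^sub>R x + (1/2) *\<^sub>R y"
    have z: "z \<in> C"
      unfolding z_def using C(2) x y(1) by (intro convexD) auto
    have N0: "0 \<le> N v" for v using order_trans[OF norm_ge_zero le_N[OF id]] .
    define d where "d = norm (x - y) / (2 * K)"
    have d0: "d \<ge> 0" unfolding d_def using K by simp
    have T_le: "norm (T z) \<le> sqrt ((N x)\<^sup>2 - d\<^sup>2)" if T: "T \<in> \<Gamma>" for T
    proof -
      have Tz: "T z = (1/2) *\<^sub>R (T x + T y)"
        unfolding z_def using lin[OF T] by (simp add: linear_add linear_scale scaleR_add_right)
      have "(norm (T z))\<^sup>2 = (norm (T x))\<^sup>2 / 2 + (norm (T y))\<^sup>2 / 2 - (norm (T x - T y) / 2)\<^sup>2"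
        unfolding Tz power2_norm_eq_inner power_divide
        by (simp add: inner_add_left inner_add_right inner_diff_left inner_diff_right
            inner_commute field_simps)
      moreover have "(norm (T x))\<^sup>2 \<le> (N x)\<^sup>2" "(norm (T y))\<^sup>2 \<le> (N x)\<^sup>2"
        using le_N[OF T, of x] le_N[OF T, of y] y(2) by (auto intro!: power_mono)
      moreover have "d \<le> norm (T x - T y) / 2"
        using lower[OF T, of "x - y"] K lin[OF T]
        by (simp add: d_def linear_diff field_simps)
      then have "d\<^sup>2 \<le> (norm (T x - T y) / 2)\<^sup>2"
        using d0 by (rule power_mono)
      ultimately have "(norm (T z))\<^sup>2 \<le> (N x)\<^sup>2 - d\<^sup>2" by linarith
      then show ?thesis by (rule real_le_rsqrt)
    qed
    then have "N z \<le> sqrt ((N x)\<^sup>2 - d\<^sup>2)"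
      by (rule N_le)
    then have "N x \<le> sqrt ((N x)\<^sup>2 - d\<^sup>2)"
      using min[OF z] by linarith
    \<comment> \<open>\<open>sqrt\<close> is negative on negative arguments, so undoing the root
      needs this sign. It follows because the root bounds \<open>norm z\<close>.\<close>
    moreover have "0 \<le> (N x)\<^sup>2 - d\<^sup>2"
      using T_le[OF id] norm_ge_zero[of z] real_sqrt_ge_0_iff[of "(N x)\<^sup>2 - d\<^sup>2"]
      by (smt (verit) id_apply)
    ultimately have "(N x)\<^sup>2 \<le> (N x)\<^sup>2 - d\<^sup>2"
      using N0[of x] by (metis power_mono real_sqrt_pow2)
    then have "d = 0" by simp
    then show ?thesis using K by (simp add: d_def)
  qed
  have "T x = x" if T: "T \<in> \<Gamma>" for T
  proof (rule uniq)
    show "T x \<in> C" using inv T x by blast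
    show "N (T x) \<le> N x"
    proof (rule N_le)
      fix S assume "S \<in> \<Gamma>"
      from le_N[OF comp[OF this T], of x] show "norm (S (T x)) \<le> N x" by simp
    qed
  qed
  with x show ?thesis by blast
qed

text \<open>Turning the canonical basis into a finite index type makes the Gram matrices of bilinear forms
  on \<open>'a\<close> elements of a Euclidean space, to which the fixed point lemma applies.\<close>

typedef (overloaded) 'a basis_index = "Basis :: 'a::euclidean_space set"
  morphisms basis_vec to_basis_index
  by (simp add: ex_in_conv)

lemma bij_basis_vec: "bij_betw basis_vec UNIV (Basis :: 'a::euclidean_space set)"
  by (simp add: bij_betw_def inj_on_def basis_vec_inject
      type_definition.Rep_range[OF type_definition_basis_index])

instance basis_index :: (euclidean_space) finite
  by standard (metis bij_basis_vec bij_betw_finite finite_Basis)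

section \<open>Gram matrices of bilinear forms\<close>

definition gram_form :: "real^('a basis_index)^('a basis_index) \<Rightarrow> 'a::euclidean_space \<Rightarrow> 'a \<Rightarrow> real"
  where "gram_form M x y =
    (\<Sum>i\<in>UNIV. \<Sum>j\<in>UNIV. M $ i $ j * (x \<bullet> basis_vec i) * (y \<bullet> basis_vec j))"

lemma basis_vec_in_Basis [simp]: "basis_vec i \<in> Basis"
  by (rule basis_vec)

lemma sum_basis_vec: "(\<Sum>i\<in>UNIV. f (basis_vec i)) = (\<Sum>b\<in>Basis. f b)"
  by (rule sum.reindex_bij_betw[OF bij_basis_vec])

lemma bilinear_gram_form: "bilinear (gram_form M)"
  unfolding bilinear_def gram_form_def
  by (auto intro!: linearI simp: inner_add_left sum.distrib sum_distrib_left
      algebra_simps)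

text \<open>Expand both arguments in the canonical basis. Together with
  \<open>gram_form_basis\<close> this identifies matrices with bilinear forms.\<close>

lemma gram_form_matrix:
  assumes "bilinear f"
  shows "gram_form (\<chi> i j. f (basis_vec i) (basis_vec j)) x y = f x y"
proof -
  have "f x y = f (\<Sum>b\<in>Basis. (x \<bullet> b) *\<^sub>R b) (\<Sum>c\<in>Basis. (y \<bullet> c) *\<^sub>R c)"
    by (simp add: euclidean_representation)
  also have "\<dots> = (\<Sum>b\<in>Basis. \<Sum>c\<in>Basis. f b c * (x \<bullet> b) * (y \<bullet> c))"
    using assms
    by (simp add: bilinear_sum bilinear_lmul bilinear_rmul sum.cartesian_product split_def
        algebra_simps)
  also have "\<dots> = gram_form (\<chi> i j. f (basis_vec i) (basis_vec j)) x y"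
    by (simp add: gram_form_def sum_basis_vec[symmetric])
  finally show ?thesis by simp
qed

lemma gram_form_basis: "gram_form M (basis_vec i) (basis_vec j) = M $ i $ j"
proof -
  have delta: "basis_vec k \<bullet> basis_vec l = (if k = l then 1 else 0)" for k l :: "'a basis_index"
    by (simp add: inner_Basis basis_vec_inject)
  have "gram_form M (basis_vec i) (basis_vec j)
      = (\<Sum>k\<in>UNIV. \<Sum>l\<in>UNIV. if j = l then if i = k then M $ k $ l else 0 else 0)"
    unfolding gram_form_def by (intro sum.cong refl) (simp add: delta)
  then show ?thesis by simp
qed

lemma gram_form_add: "gram_form (M + N) x y = gram_form M x y + gram_form N x y"
  by (simp add: gram_form_def sum.distrib algebra_simps)

lemma gram_form_scale: "gram_form (c *\<^sub>R M) x y = c * gram_form M x y"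
  by (simp add: gram_form_def sum_distrib_left algebra_simps)

lemma linear_gram_form: "linear (\<lambda>M. gram_form M x y)"
  by (rule linearI) (simp_all add: gram_form_add gram_form_scale)

text \<open>A crude termwise estimate; its purpose is to bound the group action on matrices
  uniformly.\<close>

lemma gram_form_bound:
  fixes M :: "real^('a basis_index)^('a::euclidean_space basis_index)"
  shows "\<bar>gram_form M x y\<bar> \<le> (real CARD('a basis_index))\<^sup>2 * norm M * norm x * norm y"
proof -
  have "\<bar>gram_form M x y\<bar>
      \<le> (\<Sum>i\<in>UNIV. \<Sum>j\<in>UNIV. \<bar>M $ i $ j * (x \<bullet> basis_vec i) * (y \<bullet> basis_vec j)\<bar>)"
    unfolding gram_form_def
    by (rule order_trans[OF sum_abs]) (intro sum_mono sum_abs)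
  also have "\<dots> \<le> (\<Sum>i\<in>(UNIV::'a basis_index set). \<Sum>j\<in>(UNIV::'a basis_index set).
      norm M * norm x * norm y)"
  proof (intro sum_mono)
    fix i j :: "'a basis_index"
    have "\<bar>M $ i $ j\<bar> \<le> norm M"
      using component_le_norm_cart[of "M $ i" j] Finite_Cartesian_Product.norm_nth_le[of M i] by linarith
    moreover have "\<bar>x \<bullet> basis_vec i\<bar> \<le> norm x" "\<bar>y \<bullet> basis_vec j\<bar> \<le> norm y"
      by (auto intro: Basis_le_norm)
    ultimately show "\<bar>M $ i $ j * (x \<bullet> basis_vec i) * (y \<bullet> basis_vec j)\<bar> \<le> norm M * norm x * norm y"
      unfolding abs_mult by (intro mult_mono) auto
  qed
  finally show ?thesis by (simp add: power2_eq_square algebra_simps)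
qed

text \<open>The group acts linearly on Gram matrices by pulling forms back, and a fixed matrix of
  this action is an invariant form.\<close>

lemma invariant_inner_product:
  fixes G :: "('a::euclidean_space \<Rightarrow> 'a) set"
  assumes lin: "\<And>T. T \<in> G \<Longrightarrow> linear T"
    and id: "id \<in> G"
    and comp: "\<And>S T. S \<in> G \<Longrightarrow> T \<in> G \<Longrightarrow> S \<circ> T \<in> G"
    and inv: "\<And>T. T \<in> G \<Longrightarrow> bij T \<and> inv T \<in> G"
    and bound: "\<And>T x. T \<in> G \<Longrightarrow> norm (T x) \<le> K * norm x"
  shows "\<exists>B. is_inner_product B \<and> (\<forall>T\<in>G. \<forall>x y. B (T x) (T y) = B x y)"
proof -
  define act :: "('a \<Rightarrow> 'a) \<Rightarrow> real^('a basis_index)^('a basis_index) \<Rightarrow> _" where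
    "act T M = (\<chi> i j. gram_form M (T (basis_vec i)) (T (basis_vec j)))" for T M
  have gram_act: "gram_form (act T M) x y = gram_form M (T x) (T y)" if "T \<in> G" for T M x y
  proof -
    have "bilinear (\<lambda>x y. gram_form M (T x) (T y))"
      using bilinear_gram_form[of M] lin[OF that] unfolding bilinear_def
      by (auto intro: linear_compose[unfolded o_def])
    then show ?thesis unfolding act_def by (rule gram_form_matrix)
  qed
  have act_id: "act id = id"
    by (simp add: act_def gram_form_basis fun_eq_iff vec_eq_iff)
  define n where "n = real CARD('a basis_index)"
  \<comment> \<open>The lower bound is what forces the fixed form to be positive definite; quantifying over all
    \<open>T\<close> makes it invariant.\<close>
  define C where "C = {M. (\<forall>x y. gram_form M x y = gram_form M y x) \<and>
     (\<forall>T\<in>G. \<forall>x. T x \<bullet> T x \<le> gram_form M x x)}"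
  \<comment> \<open>There are \<open>n\<^sup>2\<close> entries, each at most
    \<open>n\<^sup>2 * norm M * K * K\<close>; the summand 1 keeps \<open>L\<close>
    positive.\<close>
  define L where "L = n\<^sup>2 * n\<^sup>2 * K\<^sup>2 + 1"
  have act_bound: "norm (act T M) \<le> L * norm M" if T: "T \<in> G" for T M
  proof -
    have "norm (act T M) \<le> (\<Sum>i\<in>UNIV. norm (act T M $ i))"
      by (simp add: norm_vec_def L2_set_le_sum)
    also have "\<dots> \<le> (\<Sum>i\<in>UNIV. \<Sum>j\<in>UNIV. \<bar>act T M $ i $ j\<bar>)"
      by (intro sum_mono norm_le_l1_cart)
    also have "\<dots> \<le> (\<Sum>i\<in>(UNIV::'a basis_index set). \<Sum>j\<in>(UNIV::'a basis_index set).
        n\<^sup>2 * norm M * K * K)"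
    proof (intro sum_mono)
      fix i j :: "'a basis_index"
      have TK: "norm (T (basis_vec k)) \<le> K" for k
        using bound[OF T, of "basis_vec k"] by simp
      have "\<bar>act T M $ i $ j\<bar> \<le> n\<^sup>2 * norm M * norm (T (basis_vec i)) * norm (T (basis_vec j))"
        using gram_form_bound by (simp add: act_def n_def)
      also have "\<dots> \<le> n\<^sup>2 * norm M * K * K"
        using TK order_trans[OF norm_ge_zero TK] by (intro mult_mono) auto
      finally show "\<bar>act T M $ i $ j\<bar> \<le> n\<^sup>2 * norm M * K * K" .
    qed
    also have "\<dots> \<le> L * norm M"
      by (simp add: L_def n_def power2_eq_square algebra_simps)
    finally show ?thesis .
  qed
  have "\<exists>M\<in>C. \<forall>T\<in>act ` G. T M = M"
  proof (rule bounded_monoid_fixed_point[where K = L])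
    show "closed C"
    proof -
      have cont: "continuous_on UNIV (\<lambda>M. gram_form M x y)" for x y :: 'a
        by (intro linear_continuous_on linear_gram_form[THEN linear_conv_bounded_linear[THEN iffD1]])
      show ?thesis unfolding C_def
unfolding Ball_def
        by (intro closed_Collect_conj closed_Collect_all closed_Collect_eq closed_Collect_imp
            open_Collect_const closed_Collect_le cont continuous_on_const)
    qed
    show "convex C"
    proof (rule convexI)
      fix M N :: "real^('a basis_index)^('a basis_index)" and s t :: real
      assume MN: "M \<in> C" "N \<in> C" and st: "0 \<le> s" "0 \<le> t" "s + t = 1"
      have eq: "gram_form (s *\<^sub>R M + t *\<^sub>R N) x y = s * gram_form M x y + t * gram_form N x y" for x y
        by (simp add: gram_form_add gram_form_scale)
      have "T x \<bullet> T x \<le> s * gram_form M x x + t * gram_form N x x" if "T \<in> G" for T x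
      proof -
        have "T x \<bullet> T x = s * (T x \<bullet> T x) + t * (T x \<bullet> T x)"
          using st(3) by (metis distrib_right mult_1)
        also have "\<dots> \<le> s * gram_form M x x + t * gram_form N x x"
          using MN st that by (intro add_mono mult_left_mono) (auto simp: C_def)
        finally show ?thesis .
      qed
      then show "s *\<^sub>R M + t *\<^sub>R N \<in> C" using MN by (auto simp: C_def eq)
    qed
    show "C \<noteq> {}"
    proof -
      \<comment> \<open>The factor \<open>K\<^sup>2\<close> makes this multiple of the built-in
        inner product dominate every \<open>T x \<bullet> T x\<close>.\<close>
      define f where "f x y = K\<^sup>2 * (x \<bullet> y)" for x y :: 'a
      have "bilinear f" unfolding bilinear_def f_def
        by (auto intro!: linearI simp: algebra_simps)
      note g = gram_form_matrix[OF this]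
      have "T x \<bullet> T x \<le> f x x" if "T \<in> G" for T x
        using power_mono[OF bound[OF that, of x], of 2]
        by (simp add: f_def power_mult_distrib power2_norm_eq_inner)
      then have "(\<chi> i j. f (basis_vec i) (basis_vec j)) \<in> C"
        unfolding C_def by (simp add: g) (simp add: f_def inner_commute)
      then show ?thesis by blast
    qed
    show "id \<in> act ` G" using id act_id by force
    show "L > 0" by (simp add: L_def add_nonneg_pos)
    fix A assume "A \<in> act ` G"
    then obtain T where T: "T \<in> G" and A: "A = act T" by blast
    \<comment> \<open>Pulling back reverses the order of composition.\<close>
    have act_act: "act S (act T M) = act (T \<circ> S) M" for S M
      unfolding act_def[of S] act_def[of "T \<circ> S"] by (simp add: gram_act[OF T])
    show "linear A" unfolding A act_def
      by (intro linearI) (auto simp: vec_eq_iff gram_form_add gram_form_scale)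
    show "norm (A M) \<le> L * norm M" for M using act_bound[OF T] A by simp
    show "A M \<in> C" if M: "M \<in> C" for M
    proof -
      \<comment> \<open>Apply the bound defining \<open>C\<close> to the group element
        \<open>S \<circ> inv T\<close> at the point \<open>T x\<close>.\<close>
      have "S x \<bullet> S x \<le> gram_form M (T x) (T x)" if S: "S \<in> G" for S x
      proof -
        have "bij T" "S \<circ> inv T \<in> G" using inv T S comp by auto
        moreover have "S x = (S \<circ> inv T) (T x)" using \<open>bij T\<close> by (simp add: bij_is_inj)
        ultimately show ?thesis using M unfolding C_def by (metis (mono_tags, lifting) mem_Collect_eq)
      qed
      then show ?thesis using M unfolding C_def A by (simp add: gram_act[OF T])
    qed
    show "norm M \<le> L * norm (A M)" for M
    proof -
      have "act (inv T) (act T M) = M"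
        unfolding act_act using inv[OF T] by (metis act_id bij_is_surj id_apply surj_iff)
      then show ?thesis using act_bound[of "inv T" "act T M"] inv[OF T] A by simp
    qed
    show "B \<circ> A \<in> act ` G" if "B \<in> act ` G" for B
      using that T comp act_act A by (auto simp: fun_eq_iff image_iff)
  qed
  then obtain M where M: "M \<in> C" and fixed: "\<And>T. T \<in> G \<Longrightarrow> act T M = M" by auto
  have "gram_form M x x > 0" if "x \<noteq> 0" for x
    using M id that unfolding C_def by (smt (verit) id_apply inner_gt_zero_iff mem_Collect_eq)
  then have "is_inner_product (gram_form M)"
    using M bilinear_gram_form by (auto simp: is_inner_product_def C_def)
  then show ?thesis using fixed gram_act by metis
qed

subsection \<open>Distinguishability and self-duality\<close>

lemma linear_functional_inner:
  fixes f :: "'a::euclidean_space \<Rightarrow> real"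
  assumes "linear f"
  obtains a where "\<And>x. f x = a \<bullet> x"
proof
  fix x
  have "f x = f (\<Sum>b\<in>Basis. (x \<bullet> b) *\<^sub>R b)"
    by (simp add: euclidean_representation)
  also have "\<dots> = (\<Sum>b\<in>Basis. f b *\<^sub>R b) \<bullet> x"
    using assms
    by (simp add: linear_sum linear_scale inner_sum_left inner_sum_right inner_commute mult.commute)
  finally show "f x = (\<Sum>b\<in>Basis. f b *\<^sub>R b) \<bullet> x" .
qed

lemma linear_level_face:
  fixes f :: "'a::euclidean_space \<Rightarrow> real"
  assumes "linear f" "convex S" "\<And>x. x \<in> S \<Longrightarrow> c \<le> f x"
  shows "{x \<in> S. f x = c} face_of S"
proof -
  obtain a where a: "\<And>x. f x = a \<bullet> x" using linear_functional_inner assms(1) by blast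
  have "S \<inter> {x. a \<bullet> x = c} face_of S"
    using assms(2,3) a by (intro face_of_Int_supporting_hyperplane_ge) auto
  then show ?thesis by (simp add: a Int_def)
qed

text \<open>The minimizers form a nonempty compact face, and an extreme point of a face is extreme
  in the whole set.\<close>

lemma linear_min_at_extreme_point:
  fixes f :: "'a::euclidean_space \<Rightarrow> real"
  assumes f: "linear f" and S: "compact S" "convex S" "S \<noteq> {}"
  obtains e where "e extreme_point_of S" "\<And>x. x \<in> S \<Longrightarrow> f e \<le> f x"
proof -
  have "continuous_on S f" using f by (simp add: linear_continuous_on linear_conv_bounded_linear)
  then obtain m where m: "m \<in> S" "\<And>x. x \<in> S \<Longrightarrow> f m \<le> f x"
    using continuous_attains_inf[OF S(1,3)] by blast
  have face: "{x \<in> S. f x = f m} face_of S"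
    using linear_level_face[OF f S(2) m(2)] by simp
  then obtain e where e: "e extreme_point_of {x \<in> S. f x = f m}"
    using extreme_point_exists_convex[of "{x \<in> S. f x = f m}"] m(1) S
      face_of_imp_compact face_of_imp_convex by blast
  then have "e extreme_point_of S" "f e = f m"
    using extreme_point_of_face[OF face] by auto
  with m that show thesis by metis
qed

lemma linear_le_if_extreme_points_le:
  fixes f :: "'a::euclidean_space \<Rightarrow> real"
  assumes f: "linear f" and S: "compact S" "convex S"
    and le: "\<And>e. e extreme_point_of S \<Longrightarrow> f e \<le> c" and x: "x \<in> S"
  shows "f x \<le> c"
proof -
  obtain e where "e extreme_point_of S" "\<And>x. x \<in> S \<Longrightarrow> - f e \<le> - f x"
    using linear_min_at_extreme_point[OF linear_compose_neg[OF f] S] x by blast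
  then show ?thesis using le x by force
qed

text \<open>The unit \<open>u\<close> plays the role of the constant 1, so an affine rescaling of
  \<open>f\<close> to the range from 0 to 1 is again linear and thus a proper effect.\<close>

lemma perfectly_distinguishableI:
  fixes f u :: "'a::euclidean_space \<Rightarrow> real"
  assumes u: "linear u" "\<And>w. w \<in> \<Omega> \<Longrightarrow> u w = 1" and f: "linear f"
    and "\<phi> \<in> \<Omega>" "\<omega> \<in> \<Omega>" and less: "f \<phi> < f \<omega>"
    and range: "\<And>x. x \<in> \<Omega> \<Longrightarrow> f \<phi> \<le> f x \<and> f x \<le> f \<omega>"
  shows "perfectly_distinguishable \<Omega> \<phi> \<omega>"
proof -
  define E where "E x = (f x - f \<phi> * u x) / (f \<omega> - f \<phi>)" for x
  have E: "linear E" unfolding E_def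
    using u(1) f by (auto intro!: linearI simp: linear_add linear_scale algebra_simps
        add_divide_distrib diff_divide_distrib)
  have \<Omega>: "0 \<le> E w \<and> E w \<le> 1" if "w \<in> \<Omega>" for w
    using range[OF that] less u(2)[OF that] by (simp add: E_def)
  have "proper_effect \<Omega> E"
    using E \<Omega> by (auto simp: proper_effect_def effect_cone_def state_cone_def linear_scale)
  moreover have "E \<phi> = 0" "E \<omega> = 1" using assms by (auto simp: E_def)
  ultimately show ?thesis using assms by (auto simp: perfectly_distinguishable_def)
qed

lemma linear_eq_if_eq_on_states:
  fixes f g :: "'a::euclidean_space \<Rightarrow> real"
  assumes "span (state_cone \<Omega>) = UNIV" "linear f" "linear g" "\<And>w. w \<in> \<Omega> \<Longrightarrow> f w = g w"
  shows "f x = g x"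
proof -
  have "f y = g y" if "y \<in> state_cone \<Omega>" for y
    using that assms by (auto simp: state_cone_def linear_scale)
  then show ?thesis
    using linear_eq_on_span[OF assms(2,3), of "state_cone \<Omega>" x] assms(1) by auto
qed

text \<open>A type of class \<open>euclidean_space\<close> has positive dimension, whereas an empty
  state set would span only 0.\<close>

lemma states_nonempty:
  fixes \<Omega> :: "'a::euclidean_space set"
  assumes "span (state_cone \<Omega>) = UNIV"
  shows "\<Omega> \<noteq> {}"
proof
  assume "\<Omega> = {}"
  then have "(UNIV :: 'a set) = {0}" using assms by (simp add: state_cone_def)
  then show False using UNIV_not_singleton by blast
qed

section \<open>Calculus, projection and Riesz representation for an explicit inner product\<close>

lemma inner_product_bilinear: "is_inner_product B \<Longrightarrow> bilinear B"
  by (simp add: is_inner_product_def)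

lemma inner_product_linear:
  assumes "is_inner_product B"
  shows "linear (B x)" "linear (\<lambda>x. B x y)"
  using inner_product_bilinear[OF assms] by (simp_all add: bilinear_def)

lemma inner_product_nonneg:
  assumes "is_inner_product B"
  shows "0 \<le> B x x"
proof (cases "x = 0")
  case True
  then show ?thesis using inner_product_bilinear[OF assms] by (simp add: bilinear_lzero)
next
  case False
  then have "0 < B x x" using assms unfolding is_inner_product_def by blast
  then show ?thesis by simp
qed

lemma inner_product_eq_zero:
  assumes "is_inner_product B" "B x x \<le> 0"
  shows "x = 0"
proof (rule ccontr)
  assume "x \<noteq> 0"
  then have "0 < B x x" using assms(1) unfolding is_inner_product_def by blast
  then show False using assms(2) by simp
qed

lemma inner_product_diff_diff:
  assumes "is_inner_product B"
  shows "B (x - y) (x - y) = B x x - 2 * B x y + B y y"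
proof -
  have "bilinear B" "B y x = B x y" using assms by (auto simp: is_inner_product_def)
  then show ?thesis by (simp add: bilinear_lsub bilinear_rsub)
qed

lemma inner_product_scale:
  assumes "is_inner_product B"
  shows "B (c *\<^sub>R x) y = c * B x y" "B x (c *\<^sub>R y) = c * B x y"
  using inner_product_bilinear[OF assms] by (simp_all add: bilinear_lmul bilinear_rmul)

lemma inner_product_diff:
  assumes "is_inner_product B"
  shows "B (x - y) z = B x z - B y z" "B x (y - z) = B x y - B x z"
  using inner_product_bilinear[OF assms] by (simp_all add: bilinear_lsub bilinear_rsub)

lemma inner_product_continuous_on:
  fixes f g :: "'b::t2_space \<Rightarrow> 'a::euclidean_space"
  assumes "is_inner_product B" "continuous_on S f" "continuous_on S g"
  shows "continuous_on S (\<lambda>x. B (f x) (g x))"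
  using bilinear_continuous_on_compose[OF assms(2,3) inner_product_bilinear[OF assms(1)]] .

text \<open>The minimum of \<open>B\<close> on the unit sphere compares the norm of \<open>B\<close>
  with the built-in one. Hence the part of \<open>S\<close> no farther from \<open>e\<close> than a
  given point is compact.\<close>

lemma inner_product_closest_point:
  fixes B :: "'a::euclidean_space \<Rightarrow> 'a \<Rightarrow> real"
  assumes B: "is_inner_product B" and S: "closed S" "S \<noteq> {}"
  obtains p where "p \<in> S" "\<And>x. x \<in> S \<Longrightarrow> B (e - p) (e - p) \<le> B (e - x) (e - x)"
proof -
  have "\<exists>z\<in>sphere 0 1. \<forall>x\<in>sphere (0::'a) 1. B z z \<le> B x x"
  proof (rule continuous_attains_inf)
    show "continuous_on (sphere 0 1) (\<lambda>x. B x x)"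
      by (rule inner_product_continuous_on[OF B continuous_on_id continuous_on_id])
  qed simp_all
  then obtain z where z: "norm z = 1" "\<And>x. norm x = 1 \<Longrightarrow> B z z \<le> B x x" by auto
  define m where "m = B z z"
  have "z \<noteq> 0" using z(1) by auto
  then have m: "m > 0" using B by (simp add: m_def is_inner_product_def)
  have lower: "m * (norm x)\<^sup>2 \<le> B x x" for x
  proof (cases "x = 0")
    case False
    then have "m \<le> B ((1 / norm x) *\<^sub>R x) ((1 / norm x) *\<^sub>R x)"
      unfolding m_def by (intro z) simp
    also have "\<dots> = B x x / (norm x)\<^sup>2"
      by (simp add: inner_product_scale[OF B] power2_eq_square)
    finally show ?thesis using False by (simp add: field_simps)
  qed (simp add: inner_product_nonneg[OF B])
  obtain s where s: "s \<in> S" using S by blast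
  define D where "D = S \<inter> {x. B (e - x) (e - x) \<le> B (e - s) (e - s)}"
  have cont: "continuous_on T (\<lambda>x. B (e - x) (e - x))" for T
    by (rule inner_product_continuous_on[OF B]) (intro continuous_intros)+
  have "closed D" unfolding D_def
    by (intro closed_Int S(1) closed_Collect_le cont continuous_on_const)
  moreover have "D \<subseteq> cball e (sqrt (B (e - s) (e - s) / m))"
  proof
    fix x assume "x \<in> D"
    then have "m * (norm (e - x))\<^sup>2 \<le> B (e - s) (e - s)"
      using lower[of "e - x"] by (simp add: D_def)
    then have "(norm (e - x))\<^sup>2 \<le> B (e - s) (e - s) / m" using m by (simp add: field_simps)
    then show "x \<in> cball e (sqrt (B (e - s) (e - s) / m))"
      by (simp add: dist_norm real_le_rsqrt)
  qed
  ultimately have "compact D"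
    by (meson bounded_cball bounded_subset compact_eq_bounded_closed)
  moreover have "s \<in> D" using s by (simp add: D_def)
  ultimately have "\<exists>p\<in>D. \<forall>x\<in>D. B (e - p) (e - p) \<le> B (e - x) (e - x)"
    using continuous_attains_inf[OF _ _ cont] by blast
  then obtain p where p: "p \<in> D" "\<And>x. x \<in> D \<Longrightarrow> B (e - p) (e - p) \<le> B (e - x) (e - x)"
    by blast
  show thesis
  proof (rule that)
    show "p \<in> S" using p(1) by (simp add: D_def)
    fix x assume "x \<in> S"
    then show "B (e - p) (e - p) \<le> B (e - x) (e - x)"
      using p by (cases "x \<in> D") (auto simp: D_def)
  qed
qed

text \<open>If \<open>B v d\<close> were positive, a short step along \<open>d\<close> would shorten
  \<open>v\<close>. This turns minimal distance into the variational inequality of a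
  projection.\<close>

lemma inner_product_first_variation:
  assumes B: "is_inner_product B"
    and min: "\<And>t::real. 0 < t \<Longrightarrow> t \<le> 1 \<Longrightarrow> B v v \<le> B (v - t *\<^sub>R d) (v - t *\<^sub>R d)"
  shows "B v d \<le> 0"
proof (rule ccontr)
  assume "\<not> B v d \<le> 0"
  then have pos: "B v d > 0" by simp
  \<comment> \<open>This choice keeps \<open>t * B d d\<close> at most \<open>B v d\<close>; the
    summand 1 keeps the denominator positive.\<close>
  define t where "t = min 1 (B v d / (B d d + 1))"
  have dd: "B d d \<ge> 0" by (rule inner_product_nonneg[OF B])
  have t: "0 < t" "t \<le> 1" using pos dd by (auto simp: t_def)
  have "B (v - t *\<^sub>R d) (v - t *\<^sub>R d) = B v v - t * (2 * B v d - t * B d d)"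
    by (simp add: inner_product_diff_diff[OF B] inner_product_scale[OF B] algebra_simps)
  with min[OF t] have "t * (2 * B v d - t * B d d) \<le> 0" by simp
  then have "2 * B v d \<le> t * B d d" using t by (simp add: mult_le_0_iff)
  also have "\<dots> \<le> B v d / (B d d + 1) * B d d"
    using dd by (intro mult_right_mono) (auto simp: t_def)
  also have "\<dots> \<le> B v d"
    using dd pos by (simp add: field_simps)
  finally show False using pos by simp
qed

text \<open>Riesz representation: the map \<open>L\<close> translating \<open>B\<close> into the
  built-in inner product is injective by positive definiteness, hence surjective by
  dimension.\<close>

lemma inner_product_represents:
  fixes B :: "'a::euclidean_space \<Rightarrow> 'a \<Rightarrow> real"
  assumes B: "is_inner_product B" and E: "linear E"
  obtains e where "\<And>x. E x = B x e"
proof -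
  define L where "L e = (\<Sum>b\<in>Basis. B b e *\<^sub>R b)" for e
  have L: "x \<bullet> L e = B x e" for x e
  proof -
    have "B x e = B (\<Sum>b\<in>Basis. (x \<bullet> b) *\<^sub>R b) e" by (simp add: euclidean_representation)
    also have "\<dots> = (\<Sum>b\<in>Basis. (x \<bullet> b) * B b e)"
      using inner_product_linear(2)[OF B, of e]
      by (simp add: linear_sum[of "\<lambda>x. B x e"] inner_product_scale[OF B])
    finally show ?thesis by (simp add: L_def inner_sum_right mult.commute)
  qed
  have "linear L" unfolding L_def using inner_product_linear(1)[OF B]
    by (auto intro!: linearI simp: linear_add linear_scale scaleR_add_left sum.distrib scaleR_sum_right)
  moreover have "inj L"
    unfolding linear_injective_0[OF \<open>linear L\<close>]
    using L B by (metis inner_product_eq_zero inner_zero_right order_refl)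
  ultimately have "surj L" by (rule linear_inj_imp_surj)
  obtain a where a: "\<And>x. E x = a \<bullet> x" using linear_functional_inner E by blast
  obtain e where "L e = a" using \<open>surj L\<close> by (metis surjD)
  then have "E x = B x e" for x using a[of x] L[of x e] by (simp add: inner_commute)
  then show thesis by (rule that)
qed

section \<open>Self-duality from orthogonality of distinguishable states\<close>

text \<open>Nonnegativity on states puts the cone inside its dual. Conversely, the vector
  representing an effect is projected onto the cone, and the residual turns out to be 0.\<close>

lemma self_dual_if_distinguishable_orthogonal:
  fixes \<Omega> :: "'a::euclidean_space set" and u :: "'a \<Rightarrow> real"
  assumes \<Omega>: "compact \<Omega>" "convex \<Omega>" "span (state_cone \<Omega>) = UNIV"
    and u: "linear u" "\<And>w. w \<in> \<Omega> \<Longrightarrow> u w = 1"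
    and B: "is_inner_product B"
    and nonneg: "\<And>v w. v \<in> \<Omega> \<Longrightarrow> w \<in> \<Omega> \<Longrightarrow> 0 \<le> B v w"
    and orth: "\<And>v w. perfectly_distinguishable \<Omega> v w \<Longrightarrow> B v w = 0"
  shows "self_dual_wrt \<Omega> B"
proof -
  have comm: "B x y = B y x" for x y using B by (simp add: is_inner_product_def)
  note scale = inner_product_scale[OF B] and lin = inner_product_linear[OF B]
    and diff = inner_product_diff[OF B]
  define K where "K = state_cone \<Omega>"
  have K_hull: "K = conic hull \<Omega>" by (simp add: K_def state_cone_def conic_hull_explicit)
  \<comment> \<open>The conic hull of a compact set that avoids 0 is closed, which the projection
    requires.\<close>
  have "0 \<notin> \<Omega>" using u(2)[of 0] linear_0[OF u(1)] by auto
  then have closed: "closed K" unfolding K_hull using \<Omega>(1) by (intro closed_conic_hull) auto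
  have cone_scale: "c *\<^sub>R x \<in> K" if "x \<in> K" "0 \<le> c" for c x
    using that by (simp add: K_hull conic_mul conic_conic_hull)
  have cone_add: "x + y \<in> K" if "x \<in> K" "y \<in> K" for x y
  proof -
    have "convex K" unfolding K_hull using \<Omega>(2) by (rule convex_conic_hull)
    then have "(1/2) *\<^sub>R x + (1/2) *\<^sub>R y \<in> K" using that by (intro convexD) auto
    from cone_scale[OF this, of 2] show ?thesis by (simp add: scaleR_add_right)
  qed
  have \<Omega>_K: "w \<in> K" if "w \<in> \<Omega>" for w
    using that hull_inc K_hull by metis
  have nonzero_if: "n = 0" if "\<And>w. w \<in> \<Omega> \<Longrightarrow> B n w = 0" for n
  proof -
    have "B n n = 0"
      using linear_eq_if_eq_on_states[OF \<Omega>(3) lin(1)[of n] linear_zero] that by blast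
    then show ?thesis using inner_product_eq_zero[OF B] by simp
  qed
  have "\<exists>e\<in>K. E = (\<lambda>x. B x e)" if E: "E \<in> effect_cone \<Omega>" for E
  proof -
    have Elin: "linear E" and Epos: "\<And>x. x \<in> K \<Longrightarrow> 0 \<le> E x"
      using E by (auto simp: effect_cone_def K_def)
    obtain e where e: "\<And>x. E x = B x e" using inner_product_represents[OF B Elin] by blast
    obtain w0 where w0: "w0 \<in> \<Omega>"
      using states_nonempty[OF \<Omega>(3)] by blast
    have "K \<noteq> {}" using \<Omega>_K[OF w0] by blast
    obtain p where p: "p \<in> K" and min: "\<And>x. x \<in> K \<Longrightarrow> B (e - p) (e - p) \<le> B (e - x) (e - x)"
      using inner_product_closest_point[OF B closed \<open>K \<noteq> {}\<close>] by blast
    \<comment> \<open>Moreau decomposition: \<open>n\<close> lies in the dual cone and is orthogonal to \<open>p\<close>. If \<open>n\<close> were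
      nonzero, a state maximizing it would be perfectly distinguishable from the state on the ray of
      \<open>p\<close>, hence orthogonal to \<open>p\<close>, and \<open>e = p - n\<close> would make \<open>E\<close> negative there.\<close>
    define n where "n = p - e"
    have Bn: "B n y = B p y - B e y" for y
      by (simp add: n_def diff)
    \<comment> \<open>The cone is closed under addition, so moving from \<open>p\<close> along
      \<open>y\<close> stays inside it.\<close>
    have n_pos: "0 \<le> B n y" if y: "y \<in> K" for y
    proof -
      have "B (e - p) y \<le> 0"
      proof (rule inner_product_first_variation[OF B])
        fix t :: real assume "0 < t"
        then show "B (e - p) (e - p) \<le> B (e - p - t *\<^sub>R y) (e - p - t *\<^sub>R y)"
          using min[OF cone_add[OF p cone_scale[OF y, of t]]] by (simp add: algebra_simps)
      qed
      then show ?thesis by (simp add: n_def diff)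
    qed
    \<comment> \<open>Moving from \<open>p\<close> in direction \<open>- p\<close> gives
      \<open>(1 - t) *\<^sub>R p\<close>, which is in the cone as long as
      \<open>t \<le> 1\<close>.\<close>
    have n_p: "B n p \<le> 0"
    proof -
      have "B (e - p) (- p) \<le> 0"
      proof (rule inner_product_first_variation[OF B])
        fix t :: real assume "0 < t" "t \<le> 1"
        then show "B (e - p) (e - p) \<le> B (e - p - t *\<^sub>R (- p)) (e - p - t *\<^sub>R (- p))"
          using min[OF cone_scale[OF p, of "1 - t"]] by (simp add: algebra_simps)
      qed
      then show ?thesis using linear_neg[OF lin(1)]
        by (simp add: n_def diff)
    qed
    have "n = 0"
    proof (rule ccontr)
      assume n0: "n \<noteq> 0"
      have n_\<Omega>: "\<exists>w\<in>\<Omega>. B n w > 0"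
        using nonzero_if[of n] n0 n_pos \<Omega>_K by (metis less_eq_real_def)
      obtain s \<phi> where s: "p = s *\<^sub>R \<phi>" "0 \<le> s" "\<phi> \<in> \<Omega>"
        using p by (auto simp: K_def state_cone_def)
      \<comment> \<open>If \<open>p = 0\<close> then \<open>n = - e\<close>, so a state with
        \<open>B n w > 0\<close> would make \<open>E\<close> negative.\<close>
      have "s \<noteq> 0"
      proof
        assume "s = 0"
        then have "B n w = - E w" for w
          using Bn[of w] e[of w] comm[of e w] scale(1)[of 0 _ w] by (simp add: s)
        then show False using n_\<Omega> Epos \<Omega>_K by (metis neg_0_less_iff_less not_le)
      qed
      then have "B n \<phi> \<le> 0"
        using n_p s by (simp add: scale mult_le_0_iff)
      then have n_\<phi>: "B n \<phi> = 0" using n_pos[OF \<Omega>_K[OF s(3)]] by simp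
      have "continuous_on \<Omega> (B n)"
        using lin(1) by (simp add: linear_continuous_on linear_conv_bounded_linear)
      then obtain \<omega> where \<omega>: "\<omega> \<in> \<Omega>" "\<And>w. w \<in> \<Omega> \<Longrightarrow> B n w \<le> B n \<omega>"
        using continuous_attains_sup[OF \<Omega>(1), of "B n"] w0 by blast
      have n_\<omega>: "B n \<omega> > 0" using n_\<Omega> \<omega>(2) by force
      have "perfectly_distinguishable \<Omega> \<phi> \<omega>"
      proof (rule perfectly_distinguishableI[OF u lin(1)])
        show "B n \<phi> \<le> B n x \<and> B n x \<le> B n \<omega>" if "x \<in> \<Omega>" for x
          using that n_\<phi> n_pos \<Omega>_K \<omega>(2) by simp
      qed (use n_\<phi> n_\<omega> s \<omega> in auto)
      then have "B p \<omega> = 0" using orth by (simp add: s scale)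
      then have "E \<omega> < 0" using n_\<omega> Bn[of \<omega>] e[of \<omega>] comm[of e \<omega>] by simp
      then show False using Epos[OF \<Omega>_K[OF \<omega>(1)]] by simp
    qed
    then have "e \<in> K" using p by (simp add: n_def)
    then show ?thesis using e by blast
  qed
  moreover have "(\<lambda>x. B x e) \<in> effect_cone \<Omega>" if "e \<in> state_cone \<Omega>" for e
    using that nonneg lin(2) by (auto simp: effect_cone_def state_cone_def scale)
  ultimately show ?thesis using B by (auto simp: self_dual_wrt_def K_def)
qed

subsection \<open>Bit symmetry\<close>

text \<open>The level sets of \<open>E\<close> at 0 and 1 are faces, so their extreme points are
  pure and are distinguished by the same \<open>E\<close>. The bound \<open>B v w \<le> 0\<close>
  then spreads from extreme points to both faces, one argument at a time.\<close>

lemma mixed_distinguishable_orthogonal: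
  fixes \<Omega> :: "'a::euclidean_space set"
  assumes \<Omega>: "compact \<Omega>" "convex \<Omega>"
    and B: "is_inner_product B"
    and nonneg: "\<And>v w. v \<in> \<Omega> \<Longrightarrow> w \<in> \<Omega> \<Longrightarrow> 0 \<le> B v w"
    and pure: "\<And>v w. \<lbrakk>pure_state \<Omega> v; pure_state \<Omega> w;
      perfectly_distinguishable \<Omega> v w\<rbrakk> \<Longrightarrow> B v w = 0"
    and dist: "perfectly_distinguishable \<Omega> \<phi> \<omega>"
  shows "B \<phi> \<omega> = 0"
proof -
  obtain E where E: "proper_effect \<Omega> E" "E \<phi> = 0" "E \<omega> = 1"
    and states: "\<phi> \<in> \<Omega>" "\<omega> \<in> \<Omega>"
    using dist by (auto simp: perfectly_distinguishable_def)
  have Elin: "linear E" and E01: "\<And>w. w \<in> \<Omega> \<Longrightarrow> 0 \<le> E w \<and> E w \<le> 1"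
    using E(1) by (auto simp: proper_effect_def effect_cone_def)
  define F where "F c = {w \<in> \<Omega>. E w = c}" for c
  have F0: "F 0 face_of \<Omega>"
    using linear_level_face[OF Elin \<Omega>(2)] E01 by (simp add: F_def)
  have "{w \<in> \<Omega>. - E w = - 1} face_of \<Omega>"
    using linear_level_face[OF linear_compose_neg[OF Elin] \<Omega>(2), where c = "- 1"] E01 by simp
  then have F1: "F 1 face_of \<Omega>" by (simp add: F_def)
  note cc = face_of_imp_compact[OF \<Omega>(2,1)] face_of_imp_convex
  have "B v w \<le> 0" if v: "v extreme_point_of F 0" and w: "w \<in> F 1" for v w
  proof (rule linear_le_if_extreme_points_le[OF inner_product_linear(1)[OF B] cc(1,2)[OF F1] _ w])
    fix w' assume w': "w' extreme_point_of F 1"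
    have "pure_state \<Omega> v" "pure_state \<Omega> w'" "v \<in> F 0" "w' \<in> F 1"
      using v w' extreme_point_of_face[OF F0] extreme_point_of_face[OF F1]
      by (auto simp: pure_state_def)
    moreover from this have "perfectly_distinguishable \<Omega> v w'"
      using E(1) by (auto simp: perfectly_distinguishable_def F_def)
    ultimately show "B v w' \<le> 0" using pure by simp
  qed
  then have "B v \<omega> \<le> 0" if "v extreme_point_of F 0" for v
    using that states E by (simp add: F_def)
  then have "B \<phi> \<omega> \<le> 0"
    using linear_le_if_extreme_points_le[OF inner_product_linear(2)[OF B] cc(1,2)[OF F0]]
      states E by (simp add: F_def)
  then show ?thesis using nonneg[OF states] by simp
qed

text \<open>An extreme point of a larger convex set lies off the relative interior, so a supporting
  functional is maximal there and not constant. A pure minimizer of this functional is the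
  partner.\<close>

lemma pure_state_has_distinguishable_partner:
  fixes \<Omega> :: "'a::euclidean_space set" and u :: "'a \<Rightarrow> real"
  assumes \<Omega>: "compact \<Omega>" "convex \<Omega>"
    and u: "linear u" "\<And>w. w \<in> \<Omega> \<Longrightarrow> u w = 1"
    and \<omega>: "pure_state \<Omega> \<omega>" and ne: "\<Omega> \<noteq> {\<omega>}"
  obtains \<phi> where "pure_state \<Omega> \<phi>" "perfectly_distinguishable \<Omega> \<phi> \<omega>"
proof -
  have \<omega>_in: "\<omega> \<in> \<Omega>" using \<omega> by (simp add: pure_state_def extreme_point_of_def)
  have "\<omega> \<notin> rel_interior \<Omega>"
    using \<omega> ne extreme_point_not_in_REL_INTERIOR by (auto simp: pure_state_def)
  moreover have cl: "closure \<Omega> = \<Omega>" using \<Omega>(1) by (simp add: compact_imp_closed)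
  ultimately obtain a where a: "\<And>y. y \<in> \<Omega> \<Longrightarrow> a \<bullet> \<omega> \<le> a \<bullet> y"
      "\<And>y. y \<in> rel_interior \<Omega> \<Longrightarrow> a \<bullet> \<omega> < a \<bullet> y"
    using supporting_hyperplane_relative_frontier[OF \<Omega>(2), of \<omega>] \<omega>_in by metis
  define f where "f x = - (a \<bullet> x)" for x
  have f: "linear f" unfolding f_def by (auto intro!: linearI simp: inner_add_right)
  obtain \<phi> where \<phi>: "\<phi> extreme_point_of \<Omega>" "\<And>x. x \<in> \<Omega> \<Longrightarrow> f \<phi> \<le> f x"
    using linear_min_at_extreme_point[OF f \<Omega>] \<omega>_in by (metis empty_iff)
  obtain y where y: "y \<in> rel_interior \<Omega>" using rel_interior_eq_empty[OF \<Omega>(2)] \<omega>_in by blast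
  have "f y < f \<omega>" using a(2)[OF y] by (simp add: f_def)
  moreover have "f \<phi> \<le> f y" using \<phi>(2) y rel_interior_subset by blast
  ultimately have "f \<phi> < f \<omega>" by simp
  moreover have "f x \<le> f \<omega>" if "x \<in> \<Omega>" for x
    using a(1)[OF that] by (simp add: f_def)
  moreover have "\<phi> \<in> \<Omega>" using \<phi>(1) by (simp add: extreme_point_of_def)
  ultimately have "perfectly_distinguishable \<Omega> \<phi> \<omega>"
    using \<omega>_in \<phi>(2) by (intro perfectly_distinguishableI[OF u f]) auto
  with \<phi>(1) that show thesis by (auto simp: pure_state_def)
qed

text \<open>Complete both states to distinguishable pure pairs and map one pair to the other. The
  case \<open>v = w\<close> is separate because a single-state system has no such pairs.\<close>

lemma bit_symmetric_transitive:
  assumes sys: "is_system \<Omega> u G" and bit: "bit_symmetric \<Omega> G"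
    and pure: "pure_state \<Omega> v" "pure_state \<Omega> w"
  shows "\<exists>T\<in>G. T v = w"
proof (cases "v = w")
  case True
  then show ?thesis using sys by (auto simp: is_system_def intro!: bexI[of _ id])
next
  case False
  have \<Omega>: "compact \<Omega>" "convex \<Omega>" and u: "linear u" "\<And>w. w \<in> \<Omega> \<Longrightarrow> u w = 1"
    using sys by (auto simp: is_system_def)
  have "v \<in> \<Omega>" "w \<in> \<Omega>" using pure by (auto simp: pure_state_def extreme_point_of_def)
  then have "\<Omega> \<noteq> {v}" "\<Omega> \<noteq> {w}" using False by auto
  then obtain v' w' where "pure_state \<Omega> v'" "perfectly_distinguishable \<Omega> v' v"
    "pure_state \<Omega> w'" "perfectly_distinguishable \<Omega> w' w"
    using pure_state_has_distinguishable_partner[OF \<Omega> u] pure by metis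
  then show ?thesis using bit pure unfolding bit_symmetric_def by metis
qed

section \<open>Invariant form and invariant state of a system\<close>

text \<open>Compactness of the group supplies the uniform operator norm bound
  \<open>K\<close>.\<close>

lemma system_invariant_inner_product:
  assumes sys: "is_system \<Omega> u G"
  obtains B where "is_inner_product B" "\<And>T x y. T \<in> G \<Longrightarrow> B (T x) (T y) = B x y"
proof -
  have "bounded (Blinfun ` G)" using sys by (simp add: is_system_def compact_imp_bounded)
  then obtain K where K: "\<And>T. T \<in> G \<Longrightarrow> norm (Blinfun T) \<le> K"
    by (auto simp: bounded_iff)
  have bound: "norm (T x) \<le> K * norm x" if T: "T \<in> G" for T x
  proof -
    have "bounded_linear T" using sys T by (simp add: is_system_def linear_conv_bounded_linear)
    then have "norm (T x) \<le> norm (Blinfun T) * norm x"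
      by (metis bounded_linear_Blinfun_apply norm_blinfun)
    also have "\<dots> \<le> K * norm x" using K[OF T] by (simp add: mult_right_mono)
    finally show ?thesis .
  qed
  have "\<exists>B. is_inner_product B \<and> (\<forall>T\<in>G. \<forall>x y. B (T x) (T y) = B x y)"
    by (rule invariant_inner_product[where K = K]) (use sys bound in \<open>auto simp: is_system_def\<close>)
  then show thesis using that by blast
qed

lemma inner_product_scaled:
  assumes "is_inner_product B" "c > 0"
  shows "is_inner_product (\<lambda>x y. B x y / c)"
proof -
  note b = inner_product_bilinear[OF assms(1)]
  have "bilinear (\<lambda>x y. B x y / c)"
    unfolding bilinear_def
    by (auto intro!: linearI simp: bilinear_ladd[OF b] bilinear_radd[OF b] bilinear_lmul[OF b]
        bilinear_rmul[OF b] add_divide_distrib)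
  moreover have "B x y / c = B y x / c" "x \<noteq> 0 \<Longrightarrow> B x x / c > 0" for x y
    using assms by (metis is_inner_product_def, metis is_inner_product_def divide_pos_pos)
  ultimately show ?thesis by (simp add: is_inner_product_def)
qed

text \<open>The group preserves both \<open>\<Omega>\<close> and lengths, so it fixes the unique
  shortest state.\<close>

lemma invariant_state:
  assumes sys: "is_system \<Omega> u G" and B: "is_inner_product B"
    and inv: "\<And>T x y. T \<in> G \<Longrightarrow> B (T x) (T y) = B x y"
  shows "\<exists>\<mu>\<in>\<Omega>. \<forall>T\<in>G. T \<mu> = \<mu>"
proof -
  have \<Omega>: "compact \<Omega>" "convex \<Omega>" "\<Omega> \<noteq> {}" and G: "\<And>T. T \<in> G \<Longrightarrow> T ` \<Omega> = \<Omega>"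
    using sys states_nonempty[of \<Omega>] by (auto simp: is_system_def)
  have comm: "B x y = B y x" for x y using B by (simp add: is_inner_product_def)
  note diff = inner_product_diff[OF B] and dd = inner_product_diff_diff[OF B]
  obtain \<mu> where \<mu>: "\<mu> \<in> \<Omega>" and min: "\<And>x. x \<in> \<Omega> \<Longrightarrow> B (0 - \<mu>) (0 - \<mu>) \<le> B (0 - x) (0 - x)"
    using inner_product_closest_point[OF B compact_imp_closed[OF \<Omega>(1)] \<Omega>(3)] by blast
  have neg: "B (0 - x) (0 - x) = B x x" for x
    using linear_0[OF inner_product_linear(1)[OF B]] linear_0[OF inner_product_linear(2)[OF B]]
    unfolding diff by simp
  have uniq: "y = \<mu>" if y: "y \<in> \<Omega>" "B y y \<le> B \<mu> \<mu>" for y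
  proof -
    \<comment> \<open>The segment from \<open>\<mu>\<close> to \<open>y\<close> consists of states,
      so the shortest one satisfies \<open>B \<mu> \<mu> \<le> B \<mu> y\<close>; with
      \<open>B y y \<le> B \<mu> \<mu>\<close> this forces \<open>y = \<mu>\<close>.\<close>
    have "B \<mu> (\<mu> - y) \<le> 0"
    proof (rule inner_product_first_variation[OF B])
      fix t :: real assume t: "0 < t" "t \<le> 1"
      have "(1 - t) *\<^sub>R \<mu> + t *\<^sub>R y \<in> \<Omega>" using \<Omega>(2) \<mu> y(1) t by (intro convexD) auto
      then show "B \<mu> \<mu> \<le> B (\<mu> - t *\<^sub>R (\<mu> - y)) (\<mu> - t *\<^sub>R (\<mu> - y))"
        using min[of "(1 - t) *\<^sub>R \<mu> + t *\<^sub>R y"] unfolding neg by (simp add: algebra_simps)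
    qed
    then have "B (y - \<mu>) (y - \<mu>) \<le> 0"
      using y(2) by (simp add: dd diff comm[of y \<mu>])
    then show ?thesis using inner_product_eq_zero[OF B] by fastforce
  qed
  have "T \<mu> = \<mu>" if T: "T \<in> G" for T
  proof (rule uniq)
    show "T \<mu> \<in> \<Omega>" using G[OF T] \<mu> by blast
  qed (simp add: inv[OF T])
  with \<mu> show ?thesis by blast
qed

section \<open>Shifting and normalizing the invariant form\<close>

theorem theorem1:
  fixes \<Omega> :: "'a::euclidean_space set" and u :: "'a \<Rightarrow> real" and G :: "('a \<Rightarrow> 'a) set"
  assumes "is_system \<Omega> u G" and "bit_symmetric \<Omega> G"
  shows "\<exists>B. self_dual_wrt \<Omega> B \<and>
           (\<forall>w\<in>\<Omega>. \<forall>\<phi>\<in>\<Omega>. B w \<phi> \<ge> 0) \<and>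
           (\<forall>T\<in>G. \<forall>x y. B (T x) (T y) = B x y) \<and>
           (\<forall>w. pure_state \<Omega> w \<longrightarrow> B w w = 1) \<and>
           (\<forall>w \<phi>. w \<in> \<Omega> \<and> \<phi> \<in> \<Omega> \<and> perfectly_distinguishable \<Omega> w \<phi> \<longrightarrow> B w \<phi> = 0)"
proof -
  have \<Omega>: "compact \<Omega>" "convex \<Omega>" and span: "span (state_cone \<Omega>) = UNIV"
    and u: "linear u" "\<And>w. w \<in> \<Omega> \<Longrightarrow> u w = 1"
    and G_linear: "\<And>T. T \<in> G \<Longrightarrow> linear T" and G_states: "\<And>T. T \<in> G \<Longrightarrow> T ` \<Omega> = \<Omega>"
    using assms(1) by (auto simp: is_system_def)
  have ne: "\<Omega> \<noteq> {}" by (rule states_nonempty[OF span])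
  obtain A where A: "is_inner_product A" and A_inv: "\<And>T x y. T \<in> G \<Longrightarrow> A (T x) (T y) = A x y"
    using system_invariant_inner_product[OF assms(1)] by blast
  have A_comm: "A x y = A y x" for x y using A by (simp add: is_inner_product_def)
  note A_linear = inner_product_linear[OF A] and A_diff = inner_product_diff[OF A]
    and A_scale = inner_product_scale[OF A] and A_nonneg = inner_product_nonneg[OF A]
  have pure_in: "w \<in> \<Omega>" if "pure_state \<Omega> w" for w
    using that by (simp add: pure_state_def extreme_point_of_def)
  \<comment> \<open>Orthogonality is needed here for pure pairs only; mixed pairs and self-duality
    follow from the lemmas above.\<close>
  have "\<exists>B. is_inner_product B \<and> (\<forall>w\<in>\<Omega>. \<forall>\<phi>\<in>\<Omega>. B w \<phi> \<ge> 0) \<and>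
      (\<forall>T\<in>G. \<forall>x y. B (T x) (T y) = B x y) \<and> (\<forall>w. pure_state \<Omega> w \<longrightarrow> B w w = 1) \<and>
      (\<forall>v w. pure_state \<Omega> v \<and> pure_state \<Omega> w \<and> perfectly_distinguishable \<Omega> v w \<longrightarrow> B v w = 0)"
  \<comment> \<open>With a single state \<open>r - c\<close> would be 0. No pair is distinguishable
    then, and normalizing \<open>A\<close> is enough.\<close>
  proof (cases "\<exists>w. \<Omega> = {w}")
    case True
    then obtain w where w: "\<Omega> = {w}" by blast
    have "w \<noteq> 0" using u(2)[of w] linear_0[OF u(1)] w by auto
    then have "A w w > 0" using A by (simp add: is_inner_product_def)
    moreover have "v = w" if "pure_state \<Omega> v" for v using pure_in[OF that] w by simp
    moreover have "\<not> perfectly_distinguishable \<Omega> v v'" for v v'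
      using w by (auto simp: perfectly_distinguishable_def)
    ultimately show ?thesis
      using inner_product_scaled[OF A, of "A w w"] A_inv w
      by (intro exI[of _ "\<lambda>x y. A x y / A w w"]) auto
  next
    case False
    have "\<exists>\<mu>\<in>\<Omega>. \<forall>T\<in>G. T \<mu> = \<mu>"
      by (rule invariant_state[OF assms(1) A]) (rule A_inv)
    then obtain \<mu> where \<mu>: "\<mu> \<in> \<Omega>" and \<mu>_inv: "\<And>T. T \<in> G \<Longrightarrow> T \<mu> = \<mu>" by blast
    have transitive: "\<exists>T\<in>G. T v = w" if "pure_state \<Omega> v" "pure_state \<Omega> w" for v w
      using bit_symmetric_transitive[OF assms] that by blast
    obtain \<omega> where \<omega>: "pure_state \<Omega> \<omega>"
      using extreme_point_exists_convex[OF \<Omega> ne] by (auto simp: pure_state_def)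
    define r where "r = A \<omega> \<omega>"
    have r: "A w w = r" if "pure_state \<Omega> w" for w
      using transitive[OF \<omega> that] A_inv by (auto simp: r_def)
    \<comment> \<open>By transitivity \<open>A \<mu>\<close> is constant on pure states, hence on
      all states, which makes it the multiple \<open>k * u\<close> of the unit.\<close>
    have \<mu>_pure: "A \<mu> w = A \<mu> \<omega>" if "pure_state \<Omega> w" for w
      using transitive[OF \<omega> that] A_inv \<mu>_inv by metis
    define k where "k = A \<mu> \<mu>"
    have \<mu>_const: "A \<mu> x = A \<mu> \<omega>" if x: "x \<in> \<Omega>" for x
    proof (rule antisym)
      show "A \<mu> x \<le> A \<mu> \<omega>"
        using \<mu>_pure
        by (intro linear_le_if_extreme_points_le[OF A_linear(1) \<Omega> _ x]) (simp add: pure_state_def)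
      have "- A \<mu> x \<le> - A \<mu> \<omega>"
        using \<mu>_pure
        by (intro linear_le_if_extreme_points_le[OF linear_compose_neg[OF A_linear(1)] \<Omega> _ x])
          (simp add: pure_state_def)
      then show "A \<mu> \<omega> \<le> A \<mu> x" by simp
    qed
    have \<mu>_k: "A \<mu> x = k" if "x \<in> \<Omega>" for x
      using \<mu>_const[OF that] \<mu>_const[OF \<mu>] by (simp add: k_def)
    have u_scaled: "linear (\<lambda>x. c * u x)" for c
      using linear_compose_scale_right[OF u(1), of c] by simp
    have \<mu>_u: "A \<mu> x = k * u x" for x
      using linear_eq_if_eq_on_states[OF span A_linear(1)[of \<mu>] u_scaled] \<mu>_k u(2) by simp

    have "\<exists>p\<in>\<Omega> \<times> \<Omega>. \<forall>q\<in>\<Omega> \<times> \<Omega>. A (fst p) (snd p) \<le> A (fst q) (snd q)"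
    proof (rule continuous_attains_inf)
      show "compact (\<Omega> \<times> \<Omega>)" using \<Omega>(1) by (simp add: compact_Times)
      show "\<Omega> \<times> \<Omega> \<noteq> {}" using ne by simp
      show "continuous_on (\<Omega> \<times> \<Omega>) (\<lambda>p. A (fst p) (snd p))"
        by (rule inner_product_continuous_on[OF A]) (intro continuous_intros)+
    qed
    then obtain a b where ab: "a \<in> \<Omega>" "b \<in> \<Omega>"
      and ab_min: "\<And>x y. x \<in> \<Omega> \<Longrightarrow> y \<in> \<Omega> \<Longrightarrow> A a b \<le> A x y"
      by auto
    define c where "c = A a b"
    have c_min: "c \<le> A x y" if "x \<in> \<Omega>" "y \<in> \<Omega>" for x y
      using ab_min that by (simp add: c_def)
    \<comment> \<open>A minimizing pair is made pure one argument at a time, since \<open>A\<close>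
      is linear in each.\<close>
    obtain \<beta> where \<beta>: "pure_state \<Omega> \<beta>" and a\<beta>: "A a \<beta> \<le> A a b"
      using linear_min_at_extreme_point[OF A_linear(1) \<Omega> ne] ab(2) unfolding pure_state_def by metis
    obtain \<alpha> where \<alpha>: "pure_state \<Omega> \<alpha>" and \<alpha>\<beta>: "A \<alpha> \<beta> \<le> A a \<beta>"
      using linear_min_at_extreme_point[OF A_linear(2) \<Omega> ne] ab(1) unfolding pure_state_def by metis
    have \<alpha>\<beta>_c: "A \<alpha> \<beta> = c"
      using c_min[OF pure_in[OF \<alpha>] pure_in[OF \<beta>]] \<alpha>\<beta> a\<beta> by (simp add: c_def)

    \<comment> \<open>Otherwise the invariant state would be pure, hence by transitivity the only state.\<close>
    have c_less_k: "c < k"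
    proof (rule ccontr)
      assume "\<not> c < k"
      then have ge: "k \<le> A x y" if "x \<in> \<Omega>" "y \<in> \<Omega>" for x y using c_min[OF that] by simp
      \<comment> \<open>Such a \<open>y\<close> pairs with every state exactly as
        \<open>\<mu>\<close> does, and \<open>A\<close> is nondegenerate.\<close>
      have eq_\<mu>: "y = \<mu>" if "\<And>x. x \<in> \<Omega> \<Longrightarrow> A x y = k" for y
      proof -
        have "A x y = A x \<mu>" for x
          using linear_eq_if_eq_on_states[OF span A_linear(2) A_linear(2), of y \<mu>]
            that \<mu>_k A_comm by metis
        then have "A (y - \<mu>) (y - \<mu>) \<le> 0" by (simp add: A_diff(2))
        then show ?thesis using inner_product_eq_zero[OF A] by fastforce
      qed
      have "pure_state \<Omega> \<mu>"
        unfolding pure_state_def extreme_point_of_def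
      proof (intro conjI ballI notI \<mu>)
        fix y z assume yz: "y \<in> \<Omega>" "z \<in> \<Omega>" and "\<mu> \<in> open_segment y z"
        then obtain t where t: "0 < t" "t < 1" "\<mu> = (1 - t) *\<^sub>R y + t *\<^sub>R z" and "y \<noteq> z"
          by (auto simp: in_segment)
        \<comment> \<open>\<open>A x \<mu> = k\<close> is a proper average of two values that are at
          least \<open>k\<close>, so both equal \<open>k\<close>.\<close>
        have "A x y = k \<and> A x z = k" if x: "x \<in> \<Omega>" for x
        proof -
          have "k = (1 - t) * A x y + t * A x z"
            using \<mu>_k[OF x] A_comm[of \<mu> x] linear_add[OF A_linear(1)[of x]]
            unfolding t(3) by (simp add: A_scale)
          then have "(1 - t) * (A x y - k) + t * (A x z - k) = 0" by (simp add: algebra_simps)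
          moreover have "0 \<le> (1 - t) * (A x y - k)" "0 \<le> t * (A x z - k)"
            using ge[OF x] yz t by auto
          ultimately have "(1 - t) * (A x y - k) = 0" "t * (A x z - k) = 0" by linarith+
          then show ?thesis using t by simp
        qed
        then show False using eq_\<mu> \<open>y \<noteq> z\<close> by metis
      qed
      then have "{w. w extreme_point_of \<Omega>} = {\<mu>}"
        using transitive[of \<mu>] \<mu>_inv by (force simp: pure_state_def)
      then have "\<Omega> = {\<mu>}" using Krein_Milman_Minkowski[OF \<Omega>] by simp
      then show False using False by blast
    qed
    have "0 \<le> A (\<omega> - \<mu>) (\<omega> - \<mu>)" by (rule A_nonneg)
    then have "k \<le> r"
      using \<mu>_k[OF pure_in[OF \<omega>]] A_comm[of \<omega> \<mu>]
      by (simp add: inner_product_diff_diff[OF A] r_def k_def)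
    then have c_less_r: "c < r" using c_less_k by simp

    \<comment> \<open>All pure states have the same length, so Cauchy-Schwarz puts the maximum of \<open>A \<alpha>\<close> at \<open>\<alpha>\<close>.\<close>
    have "perfectly_distinguishable \<Omega> \<beta> \<alpha>"
    proof (rule perfectly_distinguishableI[OF u A_linear(1)[of \<alpha>]])
      fix x assume x: "x \<in> \<Omega>"
      have "A \<alpha> w \<le> r" if "w extreme_point_of \<Omega>" for w
        using A_nonneg[of "\<alpha> - w"] r[OF \<alpha>] r[of w] that
        by (simp add: inner_product_diff_diff[OF A] pure_state_def)
      then have "A \<alpha> x \<le> r" by (rule linear_le_if_extreme_points_le[OF A_linear(1) \<Omega> _ x])
      then show "A \<alpha> \<beta> \<le> A \<alpha> x \<and> A \<alpha> x \<le> A \<alpha> \<alpha>"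
        using c_min[OF pure_in[OF \<alpha>] x] \<alpha>\<beta>_c r[OF \<alpha>] by simp
    qed (use \<alpha> \<beta> pure_in \<alpha>\<beta>_c r c_less_r in auto)
    then have orth: "A v w = c" if "pure_state \<Omega> v" "pure_state \<Omega> w"
        "perfectly_distinguishable \<Omega> v w" for v w
      using assms(2) that \<alpha> \<beta> A_inv \<alpha>\<beta>_c A_comm unfolding bit_symmetric_def by metis

    \<comment> \<open>On states \<open>u\<close> is 1, so this lowers every value of
      \<open>A\<close> by \<open>c\<close> and remains bilinear.\<close>
    define D where "D x y = A x y - c * (u x * u y)" for x y
    have "bilinear D" unfolding bilinear_def D_def
      using bilinear_ladd[OF inner_product_bilinear[OF A]] bilinear_radd[OF inner_product_bilinear[OF A]]
      by (auto intro!: linearI simp: linear_add[OF u(1)] linear_scale[OF u(1)] A_scale algebra_simps)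
    moreover have "D x y = D y x" for x y using A_comm by (simp add: D_def mult.commute)
    moreover have "D x x > 0" if "x \<noteq> 0" for x
    proof (cases "u x = 0")
      case True
      then show ?thesis using that A by (simp add: D_def is_inner_product_def)
    next
      case False
      \<comment> \<open>Removing the component along \<open>\<mu>\<close> leaves squared length
        \<open>A x x - k * (u x * u x)\<close>, and \<open>D\<close> subtracts strictly less because
        \<open>c < k\<close>.\<close>
      have "0 \<le> A (x - u x *\<^sub>R \<mu>) (x - u x *\<^sub>R \<mu>)" by (rule A_nonneg)
      also have "\<dots> = A x x - k * (u x * u x)"
        by (simp add: inner_product_diff_diff[OF A] A_scale A_comm[of x \<mu>] \<mu>_u u(2)[OF \<mu>])
      also have "\<dots> < D x x"
        using mult_strict_right_mono[OF c_less_k, of "u x * u x"] False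
        by (metis D_def diff_strict_left_mono not_real_square_gt_zero)
      finally show ?thesis .
    qed
    ultimately have D: "is_inner_product D" by (simp add: is_inner_product_def)
    have u_inv: "u (T x) = u x" if T: "T \<in> G" for T x
    proof -
      have "(u \<circ> T) w = u w" if "w \<in> \<Omega>" for w
        using u(2)[of w] u(2)[of "T w"] G_states[OF T] that by auto
      then have "(u \<circ> T) x = u x"
        by (rule linear_eq_if_eq_on_states[OF span linear_compose[OF G_linear[OF T] u(1)] u(1)])
      then show ?thesis by simp
    qed
    show ?thesis
    \<comment> \<open>For pure \<open>w\<close> the value \<open>D w w\<close> is
      \<open>r - c\<close>, hence this normalization.\<close>
    proof (intro exI[of _ "\<lambda>x y. D x y / (r - c)"] conjI ballI allI impI)
      show "is_inner_product (\<lambda>x y. D x y / (r - c))"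
        using inner_product_scaled[OF D] c_less_r by simp
    qed (use c_min c_less_r u(2) u_inv A_inv r orth pure_in in \<open>auto simp: D_def\<close>)
  qed
  then obtain B where B: "is_inner_product B" and pos: "\<And>v w. v \<in> \<Omega> \<Longrightarrow> w \<in> \<Omega> \<Longrightarrow> 0 \<le> B v w"
    and inv: "\<And>T x y. T \<in> G \<Longrightarrow> B (T x) (T y) = B x y"
    and norm: "\<And>w. pure_state \<Omega> w \<Longrightarrow> B w w = 1"
    and pure_orth: "\<And>v w. \<lbrakk>pure_state \<Omega> v; pure_state \<Omega> w;
      perfectly_distinguishable \<Omega> v w\<rbrakk> \<Longrightarrow> B v w = 0"
    by blast
  have orth: "B v w = 0" if "perfectly_distinguishable \<Omega> v w" for v w
    using mixed_distinguishable_orthogonal[OF \<Omega> B pos pure_orth that] .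
  have "self_dual_wrt \<Omega> B"
    using self_dual_if_distinguishable_orthogonal[OF \<Omega> span u B pos orth] .
  then show ?thesis using pos inv norm orth by blast
qed

end
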